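(* (Space Consumption for $\lambda\mathsf{S}$.) If $M$ is a GTLC term with $\Gamma\vdash_G M:A$, then there exists a natural number $c$ such that for every $\lambda\mathsf{S}$ term $M':\Gamma\vdash A$ with $\mathcal C[\![M]\!]\longrightarrow_S^{*}M'$ we have $$\mathsf{real\text{-}size}(M')\le c\cdot\mathsf{ideal\text{-}size}(M').$$
   Context: **Types.** Base types $b$: $\mathtt{Nat},\mathtt{Bool},\mathtt{Int},\mathtt{Unit},\bot$. Types: $A,B,C::=b\mid\,?\mid A\to B\mid A\times B\mid A+B$; ground types $G,H::=b\mid\,?\to?\mid\,?\times?\mid\,?+?$; $\otimes$ ranges over $\{\to,\times,+\}$; $\mathsf{gnd}\,b=b$, $\mathsf{gnd}(A\otimes B)=\,?\otimes\,?$. Contexts are finite sequences of types; variables are de Bruijn indices (index $0$ is the last-added type). Primitive types $P::=b\mid b\to P$; each $b$ denotes a set (naturals, Booleans, integers, one-element set, empty set), $[\![b\to P]\!]$ is the set of functions $[\![b]\!]\to[\![P]\!]$. Blame labels $\ell$ range over a fixed set. *Consistency* $\sim$: $A\sim\,?$; $?\sim B$; $b\sim b$; $A\otimes B\sim A'\otimes B'$ if $A\sim A'$, $B\sim B'$. *Join* of consistent types: $A\sqcup\,?=A$, $?\sqcup B=B$, $b\sqcup b=b$, $(A\otimes B)\sqcup(A'\otimes B')=(A\sqcup A')\otimes(B\sqcup B')$. *Matching*: $A\triangleright A_1\otimes A_2$ iff $A=A_1\otimes A_2$, or $A=A_1=A_2=\,?$. **GTLC** typing $\Gamma\vdash_G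 M:A$: $\$k:P$ for $k\in[\![P]\!]$; $`x:A$ if $x$ has type $A$ in $\Gamma$; $\lambda[A]M:A\to B$ if $\Gamma\cdot A\vdash_G M:B$; $(L\,M)_\ell:A_2$ if $L:A$, $M:B$, $A\triangleright A_1\to A_2$, $A_1\sim B$; $\mathtt{if}_\ell\,L\,M\,N:B\sqcup C$ if $L:A$, $M:B$, $N:C$, $A\sim\mathtt{Bool}$, $B\sim C$; $\mathtt{cons}\,M\,N:A\times B$ if $M:A$, $N:B$; $\pi_i^\ell M:A_i$ if $M:A$, $A\triangleright A_1\times A_2$; $\mathtt{inl}[B]M:A+B$ if $M:A$; $\mathtt{inr}[A]M:A+B$ if $M:B$; $\mathtt{case}_\ell[B_1,C_1]\,L\,M\,N:B_2\sqcup C_2$ if $\Gamma\vdash_G L:A$, $\Gamma\cdot B_1\vdash_G M:B_2$, $\Gamma\cdot C_1\vdash_G N:C_2$, $A\sim B_1+C_1$, $B_2\sim C_2$. **Coercions of $\lambda\mathsf{S}$**, three mutually defined families: top-level $c,d:A\Rightarrow B$, intermediate $i:A\Rightarrow_iB$, ground $g,h:A\Rightarrow_gB$. - Top-level: $\mathsf{id}:\,?\Rightarrow\,?$; $(H?^\ell;i):\,?\Rightarrow B$ for $i:H\Rightarrow_iB$; any $i:A\Rightarrow_iB$. - Intermediate: $(g;G!):A\Rightarrow_i\,?$ for $g:A\Rightarrow_gG$; any $g:A\Rightarrow_gB$; $\bot^\ell:A\Rightarrow_iB$. - Ground: $\mathsf{id}:b\Rightarrow_gb$; $c\to d:(A\to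 B)\Rightarrow_g(C\to D)$ for $c:C\Rightarrow A$, $d:B\Rightarrow D$; $c\times d:(A\times B)\Rightarrow_g(C\times D)$ and $c+d:(A+B)\Rightarrow_g(C+D)$ for $c:A\Rightarrow C$, $d:B\Rightarrow D$. *Cross*: $c\otimes d$, with $\mathsf{dom}(c\to d)=c$, $\mathsf{cod}(c\to d)=d$, $\mathsf{fst}(c\times d)=c$, $\mathsf{snd}(c\times d)=d$, $\mathsf{inl}(c+d)=c$, $\mathsf{inr}(c+d)=d$. *Inert*: $c\to d$ and $g;G!$. *Active*: $\mathsf{id}$ (on $?$ and on base types), $G?^\ell;i$, $\bot^\ell$, $c\times d$, $c+d$. *Composition* $\ast$: $\mathsf{id}\ast d=d$; $(G?^\ell;i)\ast d=G?^\ell;(i\ast d)$; $(g;G!)\ast\mathsf{id}=g;G!$; $g\ast(h;H!)=(g\ast h);H!$; $(g;G!)\ast(G?^\ell;i)=g\ast i$; $(g;G!)\ast(H?^\ell;i)=\bot^\ell$ if $G\neq H$; $\bot^\ell\ast d=\bot^\ell$; $g\ast\bot^\ell=\bot^\ell$; $\mathsf{id}\ast\mathsf{id}=\mathsf{id}$; $(c_1\to d_1)\ast(c_2\to d_2)=(c_2\ast c_1)\to(d_1\ast d_2)$; $(c_1\times d_1)\ast(c_2\times d_2)=(c_1\ast c_2)\times(d_1\ast d_2)$; $(c_1+d_1)\ast(c_2+d_2)=(c_1\ast c_2)+(d_1\ast d_2)$. *Cast constructor* for $A\sim B$: $\mathrm{coerce}(?,?,\ell)=\mathsf{id}$; for $A\neq\,?$: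 $\mathrm{coerce}(A,?,\ell)=\mathrm{coerce}(A,\mathsf{gnd}\,A,\ell);(\mathsf{gnd}\,A)!$ and $\mathrm{coerce}(?,A,\ell)=(\mathsf{gnd}\,A)?^\ell;\mathrm{coerce}(\mathsf{gnd}\,A,A,\ell)$; $\mathrm{coerce}(b,b,\ell)=\mathsf{id}$; $\mathrm{coerce}(A\to B,A'\to B',\ell)=\mathrm{coerce}(A',A,\ell)\to\mathrm{coerce}(B,B',\ell)$; for $\otimes\in\{\times,+\}$, $\mathrm{coerce}(A\otimes B,A'\otimes B',\ell)=\mathrm{coerce}(A,A',\ell)\otimes\mathrm{coerce}(B,B',\ell)$. *Size of coercions*: $\mathsf{size}(\mathsf{id})=\mathsf{size}(\bot^\ell)=0$; $\mathsf{size}(G?^\ell;i)=2+\mathsf{size}(i)$; $\mathsf{size}(g;G!)=2+\mathsf{size}(g)$; $\mathsf{size}(c\otimes d)=1+\mathsf{size}(c)+\mathsf{size}(d)$. **Terms of $\lambda\mathsf{S}$** (intrinsically typed; $M:\Gamma\vdash A$): $\$k:P$; $`x:A$ if $x$ has type $A$ in $\Gamma$; $\lambda M:A\to B$ if $M:\Gamma\cdot A\vdash B$; $L\,M:B$ if $L:A\to B$, $M:A$; $\mathtt{if}\,L\,M\,N:B$ if $L:\mathtt{Bool}$, $M,N:B$; $\mathtt{cons}\,M\,N:A\times B$; $\pi_iM:A_i$ if $M:A_1\times A_2$; $\mathtt{inl}[B]M:A+B$ if $M:A$; $\mathtt{inr}[A]M:A+B$ if $M:B$; $\mathtt{case}\,L\,M\,N:B$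 if $L:A_1+A_2$, $M:A_1\to B$, $N:A_2\to B$; $M\langle c\rangle:B$ if $M:A$, $c:A\Rightarrow B$; $\mathtt{blame}\,\ell:A$ for every $A$. *Simple values* $S$: $\lambda M$; $\$k$; $\mathtt{cons}\,V\,W$; $\mathtt{inl}[B]V$; $\mathtt{inr}[A]V$. *Values* $V,W$: $S$; $S\langle c\rangle$ with $c$ inert. *Frames* $F$: $\Box\,M$; $V\,\Box$; $\mathtt{if}\,\Box\,M\,N$; $\mathtt{cons}\,V\,\Box$; $\mathtt{cons}\,\Box\,N$; $\pi_i\Box$; $\mathtt{inl}[B]\Box$; $\mathtt{inr}[A]\Box$; $\mathtt{case}\,\Box\,M\,N$. *applyCast* on simple values (simple values never have type $?$, so active coercions out of $?$ do not arise): $\mathsf{applyCast}\,S\,\mathsf{id}=S$; $\mathsf{applyCast}\,S\,\bot^\ell=\mathtt{blame}\,\ell$; $\mathsf{applyCast}(\mathtt{cons}\,V_1\,V_2)(c\times d)=\mathtt{cons}\,(V_1\langle c\rangle)\,(V_2\langle d\rangle)$; $\mathsf{applyCast}(\mathtt{inl}\,V)(c+d)=\mathtt{inl}(V\langle c\rangle)$; $\mathsf{applyCast}(\mathtt{inr}\,V)(c+d)=\mathtt{inr}(V\langle d\rangle)$ (annotations adjusted to the target type). **Reduction** $ctx\vdash M\longrightarrow_SN$, $ctx\in\{\mathtt{Any},\mathtt{NonCast}\}$ ($M[V]$ substitution for variable $0$; $\uparrow$ weakening): - $\mathtt{Any}\vdash F[M]\longrightarrow F[M']$ if $ctx\vdash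 M\longrightarrow M'$ for some $ctx$; $\mathtt{NonCast}\vdash M\langle c\rangle\longrightarrow M'\langle c\rangle$ if $\mathtt{Any}\vdash M\longrightarrow M'$. - $\mathtt{Any}\vdash F[\mathtt{blame}\,\ell]\longrightarrow\mathtt{blame}\,\ell$; $\mathtt{NonCast}\vdash(\mathtt{blame}\,\ell)\langle c\rangle\longrightarrow\mathtt{blame}\,\ell$. - $\mathtt{NonCast}\vdash S\langle c\rangle\longrightarrow\mathsf{applyCast}\,S\,c$ for $c$ active; $\mathtt{NonCast}\vdash M\langle c\rangle\langle d\rangle\longrightarrow M\langle c\ast d\rangle$. - With $ctx=\mathtt{Any}$, for $c$ cross: $V\langle c\rangle\,W\longrightarrow(V\,(W\langle\mathsf{dom}\,c\rangle))\langle\mathsf{cod}\,c\rangle$; $\pi_1(V\langle c\rangle)\longrightarrow(\pi_1V)\langle\mathsf{fst}\,c\rangle$; $\pi_2(V\langle c\rangle)\longrightarrow(\pi_2V)\langle\mathsf{snd}\,c\rangle$; $\mathtt{case}\,(V\langle c\rangle)\,M\,N\longrightarrow\mathtt{case}\,V\,(\lambda((\uparrow M)\,(`0\langle\mathsf{inl}\,c\rangle)))\,(\lambda((\uparrow N)\,(`0\langle\mathsf{inr}\,c\rangle)))$. - With $ctx=\mathtt{Any}$: $(\lambda M)V\longrightarrow M[V]$; $\mathtt{if}\,\$\mathtt{true}\,M\,N\longrightarrow M$; $\mathtt{if}\,\$\mathtt{false}\,M\,N\longrightarrow N$; $\pi_1(\mathtt{cons}\,V\,W)\longrightarrow V$;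 $\pi_2(\mathtt{cons}\,V\,W)\longrightarrow W$; $\mathtt{case}(\mathtt{inl}[B]V)\,L\,M\longrightarrow L\,V$; $\mathtt{case}(\mathtt{inr}[A]V)\,L\,M\longrightarrow M\,V$; $\$k\,\$k'\longrightarrow\$(k(k'))$. $M\longrightarrow_S^{*}M'$ means a finite (possibly empty) sequence of such steps, each in some $ctx$. **Compilation** $\mathcal C$ (types as in the typing rules, $\langle A\Rightarrow^\ell B\rangle$ short for $\langle\mathrm{coerce}(A,B,\ell)\rangle$): $\$k\mapsto\$k$; $`x\mapsto`x$; $\lambda[A]M\mapsto\lambda\,\mathcal C[\![M]\!]$; $(L\,M)_\ell\mapsto\mathcal C[\![L]\!]\langle A\Rightarrow^\ell A_1\to A_2\rangle\;\mathcal C[\![M]\!]\langle B\Rightarrow^\ell A_1\rangle$; $\mathtt{if}_\ell\,L\,M\,N\mapsto\mathtt{if}\,(\mathcal C[\![L]\!]\langle A\Rightarrow^\ell\mathtt{Bool}\rangle)\,(\mathcal C[\![M]\!]\langle B\Rightarrow^\ell B\sqcup C\rangle)\,(\mathcal C[\![N]\!]\langle C\Rightarrow^\ell B\sqcup C\rangle)$; $\mathtt{cons},\mathtt{inl}[B],\mathtt{inr}[A]$ homomorphically; $\pi_i^\ell M\mapsto\pi_i(\mathcal C[\![M]\!]\langle A\Rightarrow^\ell A_1\times A_2\rangle)$; $\mathtt{case}_\ell[B_1,C_1]\,L\,M\,N\mapsto\mathtt{case}\,(\mathcal C[\![L]\!]\langle A\Rightarrow^\ell B_1+C_1\rangle)\,(\lambda\,\mathcal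 C[\![M]\!]\langle B_2\Rightarrow^\ell B_2\sqcup C_2\rangle)\,(\lambda\,\mathcal C[\![N]\!]\langle C_2\Rightarrow^\ell B_2\sqcup C_2\rangle)$. **Sizes of terms.** $\mathsf{ideal\text{-}size}(M\langle c\rangle)=\mathsf{ideal\text{-}size}(M)$, $\mathsf{real\text{-}size}(M\langle c\rangle)=\mathsf{size}(c)+\mathsf{real\text{-}size}(M)$; for every other term constructor both sizes are $1$ plus the sum of the corresponding sizes of the immediate subterms. *)

theory Defs
  imports Main "HOL-Library.FuncSet"
begin

section \<open>Types\<close>

datatype base = BNat | BBool | BInt | BUnit | BBot

datatype tyop = ToOp | TimesOp | PlusOp

datatype ty = Base base | Dyn | Op tyop ty ty

abbreviation Arrow :: "ty \<Rightarrow> ty \<Rightarrow> ty" (infixr "\<rightarrow>\<^sub>t" 60)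
  where "A \<rightarrow>\<^sub>t B \<equiv> Op ToOp A B"
abbreviation Times :: "ty \<Rightarrow> ty \<Rightarrow> ty" (infixr "\<times>\<^sub>t" 62)
  where "A \<times>\<^sub>t B \<equiv> Op TimesOp A B"
abbreviation Plus :: "ty \<Rightarrow> ty \<Rightarrow> ty" (infixr "+\<^sub>t" 61)
  where "A +\<^sub>t B \<equiv> Op PlusOp A B"

datatype gty = GndBase base | GndOp tyop

fun ty_of_gnd :: "gty \<Rightarrow> ty" where
  "ty_of_gnd (GndBase b) = Base b"
| "ty_of_gnd (GndOp p) = Op p Dyn Dyn"

text \<open>Unspecified on \<^term>\<open>Dyn\<close>, which has no ground type.\<close>
fun gnd :: "ty \<Rightarrow> gty" where
  "gnd (Base b) = GndBase b"
| "gnd (Op p A B) = GndOp p"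

text \<open>Contexts are lists whose head is the last-added type, so that \<open>\<Gamma> ! i\<close> is the type of
  the de Bruijn index \<open>i\<close>.\<close>
type_synonym ctxt = "ty list"

inductive consistent :: "ty \<Rightarrow> ty \<Rightarrow> bool" (infix "\<sim>" 50) where
  "A \<sim> Dyn"
| "Dyn \<sim> B"
| "Base b \<sim> Base b"
| "A \<sim> A' \<Longrightarrow> B \<sim> B' \<Longrightarrow> Op p A B \<sim> Op p A' B'"

text \<open>Only used on consistent types; the other cases are irrelevant.\<close>
fun join :: "ty \<Rightarrow> ty \<Rightarrow> ty" (infixl "\<squnion>\<^sub>t" 65) where
  "A \<squnion>\<^sub>t Dyn = A"
| "Dyn \<squnion>\<^sub>t B = B"
| "Base b \<squnion>\<^sub>t Base b' = Base b"
| "Op p A B \<squnion>\<^sub>t Op p' A' B' = Op p (A \<squnion>\<^sub>t A') (B \<squnion>\<^sub>t B')"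

inductive matches :: "tyop \<Rightarrow> ty \<Rightarrow> ty \<Rightarrow> ty \<Rightarrow> bool" for p where
  "matches p (Op p A1 A2) A1 A2"
| "matches p Dyn Dyn Dyn"

text \<open>The components \<open>A1\<close>, \<open>A2\<close> of a type that matches \<open>A1 \<otimes> A2\<close>.\<close>
fun mfst :: "ty \<Rightarrow> ty" where
  "mfst (Op p A1 A2) = A1"
| "mfst Dyn = Dyn"

fun msnd :: "ty \<Rightarrow> ty" where
  "msnd (Op p A1 A2) = A2"
| "msnd Dyn = Dyn"

section \<open>Primitive constants\<close>

datatype prim = PBase base | PFun base prim

fun ty_of_prim :: "prim \<Rightarrow> ty" where
  "ty_of_prim (PBase b) = Base b"
| "ty_of_prim (PFun b P) = (Base b \<rightarrow>\<^sub>t ty_of_prim P)"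

datatype bval = VNat nat | VBool bool | VInt int | VUnit

datatype den = DBase bval | DFun "bval \<Rightarrow> den"

fun base_sem :: "base \<Rightarrow> bval set" where
  "base_sem BNat = range VNat"
| "base_sem BBool = range VBool"
| "base_sem BInt = range VInt"
| "base_sem BUnit = {VUnit}"
| "base_sem BBot = {}"

text \<open>The functions from \<open>\<lbrakk>b\<rbrakk>\<close> to \<open>\<lbrakk>P\<rbrakk>\<close> are represented by the extensional ones, so that a
  function is determined by its values on \<open>\<lbrakk>b\<rbrakk>\<close>.\<close>
fun prim_sem :: "prim \<Rightarrow> den set" where
  "prim_sem (PBase b) = DBase ` base_sem b"
| "prim_sem (PFun b P) = DFun ` (base_sem b \<rightarrow>\<^sub>E prim_sem P)"

section \<open>The gradually typed lambda calculus\<close>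

text \<open>The type parameter \<open>'l\<close> is the set of blame labels.\<close>
datatype 'l gterm =
    GConst den prim
  | GVar nat
  | GLam ty "'l gterm"
  | GApp "'l gterm" "'l gterm" 'l
  | GIf 'l "'l gterm" "'l gterm" "'l gterm"
  | GCons "'l gterm" "'l gterm"
  | GFst 'l "'l gterm"
  | GSnd 'l "'l gterm"
  | GInl ty "'l gterm"
  | GInr ty "'l gterm"
  | GCase 'l ty ty "'l gterm" "'l gterm" "'l gterm"

inductive gtyping :: "ctxt \<Rightarrow> 'l gterm \<Rightarrow> ty \<Rightarrow> bool" ("_ \<turnstile>\<^sub>G _ : _" [51, 51, 51] 50) where
  "k \<in> prim_sem P \<Longrightarrow> \<Gamma> \<turnstile>\<^sub>G GConst k P : ty_of_prim P"
| "x < length \<Gamma> \<Longrightarrow> \<Gamma> \<turnstile>\<^sub>G GVar x : \<Gamma> ! x"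
| "A # \<Gamma> \<turnstile>\<^sub>G M : B \<Longrightarrow> \<Gamma> \<turnstile>\<^sub>G GLam A M : A \<rightarrow>\<^sub>t B"
| "\<Gamma> \<turnstile>\<^sub>G L : A \<Longrightarrow> \<Gamma> \<turnstile>\<^sub>G M : B \<Longrightarrow> matches ToOp A A1 A2 \<Longrightarrow> A1 \<sim> B \<Longrightarrow>
   \<Gamma> \<turnstile>\<^sub>G GApp L M l : A2"
| "\<Gamma> \<turnstile>\<^sub>G L : A \<Longrightarrow> \<Gamma> \<turnstile>\<^sub>G M : B \<Longrightarrow> \<Gamma> \<turnstile>\<^sub>G N : C \<Longrightarrow> A \<sim> Base BBool \<Longrightarrow> B \<sim> C \<Longrightarrow>
   \<Gamma> \<turnstile>\<^sub>G GIf l L M N : B \<squnion>\<^sub>t C"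
| "\<Gamma> \<turnstile>\<^sub>G M : A \<Longrightarrow> \<Gamma> \<turnstile>\<^sub>G N : B \<Longrightarrow> \<Gamma> \<turnstile>\<^sub>G GCons M N : A \<times>\<^sub>t B"
| "\<Gamma> \<turnstile>\<^sub>G M : A \<Longrightarrow> matches TimesOp A A1 A2 \<Longrightarrow> \<Gamma> \<turnstile>\<^sub>G GFst l M : A1"
| "\<Gamma> \<turnstile>\<^sub>G M : A \<Longrightarrow> matches TimesOp A A1 A2 \<Longrightarrow> \<Gamma> \<turnstile>\<^sub>G GSnd l M : A2"
| "\<Gamma> \<turnstile>\<^sub>G M : A \<Longrightarrow> \<Gamma> \<turnstile>\<^sub>G GInl B M : A +\<^sub>t B"
| "\<Gamma> \<turnstile>\<^sub>G M : B \<Longrightarrow> \<Gamma> \<turnstile>\<^sub>G GInr A M : A +\<^sub>t B"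
| "\<Gamma> \<turnstile>\<^sub>G L : A \<Longrightarrow> B1 # \<Gamma> \<turnstile>\<^sub>G M : B2 \<Longrightarrow> C1 # \<Gamma> \<turnstile>\<^sub>G N : C2 \<Longrightarrow> A \<sim> B1 +\<^sub>t C1 \<Longrightarrow> B2 \<sim> C2 \<Longrightarrow>
   \<Gamma> \<turnstile>\<^sub>G GCase l B1 C1 L M N : B2 \<squnion>\<^sub>t C2"

lemma matches_unique: "matches p A A1 A2 \<Longrightarrow> mfst A = A1 \<and> msnd A = A2"
  by (auto elim: matches.cases)

inductive_cases gtyping_elims:
  "\<Gamma> \<turnstile>\<^sub>G GConst k P : A" "\<Gamma> \<turnstile>\<^sub>G GVar x : A" "\<Gamma> \<turnstile>\<^sub>G GLam B M : A" "\<Gamma> \<turnstile>\<^sub>G GApp L M l : A"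
  "\<Gamma> \<turnstile>\<^sub>G GIf l L M N : A" "\<Gamma> \<turnstile>\<^sub>G GCons M N : A" "\<Gamma> \<turnstile>\<^sub>G GFst l M : A" "\<Gamma> \<turnstile>\<^sub>G GSnd l M : A"
  "\<Gamma> \<turnstile>\<^sub>G GInl B M : A" "\<Gamma> \<turnstile>\<^sub>G GInr B M : A" "\<Gamma> \<turnstile>\<^sub>G GCase l B1 C1 L M N : A"

lemma gtyping_unique: "\<Gamma> \<turnstile>\<^sub>G M : A \<Longrightarrow> \<Gamma> \<turnstile>\<^sub>G M : B \<Longrightarrow> A = B"
  by (induction arbitrary: B rule: gtyping.induct)
     (erule gtyping_elims, (metis matches_unique | blast))+

definition gtype_of :: "ctxt \<Rightarrow> 'l gterm \<Rightarrow> ty" where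
  "gtype_of \<Gamma> M = (THE A. \<Gamma> \<turnstile>\<^sub>G M : A)"

lemma gtype_of_eq: "\<Gamma> \<turnstile>\<^sub>G M : A \<Longrightarrow> gtype_of \<Gamma> M = A"
  unfolding gtype_of_def by (blast intro: gtyping_unique)

section \<open>Coercions\<close>

text \<open>Top-level, intermediate and ground coercions. The constructors \<open>Mid\<close> and \<open>Gnd\<close> are the
  inclusions of the intermediate into the top-level and of the ground into the intermediate
  coercions, \<open>Proj H l i\<close> is \<open>H?\<^sup>l; i\<close> and \<open>Inj g G\<close> is \<open>g; G!\<close>. The coercion \<open>\<bottom>\<^sup>l\<close> records its
  source and target type, so that every coercion determines the types between which it
  coerces.\<close>
datatype 'l crcn =
    IdDyn
  | Proj gty 'l "'l icrcn"
  | Mid "'l icrcn"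
and 'l icrcn =
    Inj "'l gcrcn" gty
  | Gnd "'l gcrcn"
  | Fail ty 'l ty
and 'l gcrcn =
    IdBase base
  | Cross tyop "'l crcn" "'l crcn"

abbreviation CrossC :: "tyop \<Rightarrow> 'l crcn \<Rightarrow> 'l crcn \<Rightarrow> 'l crcn" where
  "CrossC p c d \<equiv> Mid (Gnd (Cross p c d))"

inductive ctyping :: "'l crcn \<Rightarrow> ty \<Rightarrow> ty \<Rightarrow> bool" ("_ : _ \<Rightarrow>\<^sub>c _" [51, 51, 51] 50)
  and ityping :: "'l icrcn \<Rightarrow> ty \<Rightarrow> ty \<Rightarrow> bool" ("_ : _ \<Rightarrow>\<^sub>i _" [51, 51, 51] 50)
  and gctyping :: "'l gcrcn \<Rightarrow> ty \<Rightarrow> ty \<Rightarrow> bool" ("_ : _ \<Rightarrow>\<^sub>g _" [51, 51, 51] 50) where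
  "IdDyn : Dyn \<Rightarrow>\<^sub>c Dyn"
| "i : ty_of_gnd H \<Rightarrow>\<^sub>i B \<Longrightarrow> Proj H l i : Dyn \<Rightarrow>\<^sub>c B"
| "i : A \<Rightarrow>\<^sub>i B \<Longrightarrow> Mid i : A \<Rightarrow>\<^sub>c B"
| "g : A \<Rightarrow>\<^sub>g ty_of_gnd G \<Longrightarrow> Inj g G : A \<Rightarrow>\<^sub>i Dyn"
| "g : A \<Rightarrow>\<^sub>g B \<Longrightarrow> Gnd g : A \<Rightarrow>\<^sub>i B"
| "Fail A l B : A \<Rightarrow>\<^sub>i B"
| "IdBase b : Base b \<Rightarrow>\<^sub>g Base b"
| "c : C \<Rightarrow>\<^sub>c A \<Longrightarrow> d : B \<Rightarrow>\<^sub>c D \<Longrightarrow> Cross ToOp c d : (A \<rightarrow>\<^sub>t B) \<Rightarrow>\<^sub>g (C \<rightarrow>\<^sub>t D)"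
| "c : A \<Rightarrow>\<^sub>c C \<Longrightarrow> d : B \<Rightarrow>\<^sub>c D \<Longrightarrow> Cross TimesOp c d : (A \<times>\<^sub>t B) \<Rightarrow>\<^sub>g (C \<times>\<^sub>t D)"
| "c : A \<Rightarrow>\<^sub>c C \<Longrightarrow> d : B \<Rightarrow>\<^sub>c D \<Longrightarrow> Cross PlusOp c d : (A +\<^sub>t B) \<Rightarrow>\<^sub>g (C +\<^sub>t D)"

fun csrc :: "'l crcn \<Rightarrow> ty" and ctgt :: "'l crcn \<Rightarrow> ty"
  and isrc :: "'l icrcn \<Rightarrow> ty" and itgt :: "'l icrcn \<Rightarrow> ty"
  and gsrc :: "'l gcrcn \<Rightarrow> ty" and gtgt :: "'l gcrcn \<Rightarrow> ty" where
  "csrc IdDyn = Dyn"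
| "csrc (Proj H l i) = Dyn"
| "csrc (Mid i) = isrc i"
| "ctgt IdDyn = Dyn"
| "ctgt (Proj H l i) = itgt i"
| "ctgt (Mid i) = itgt i"
| "isrc (Inj g G) = gsrc g"
| "isrc (Gnd g) = gsrc g"
| "isrc (Fail A l B) = A"
| "itgt (Inj g G) = Dyn"
| "itgt (Gnd g) = gtgt g"
| "itgt (Fail A l B) = B"
| "gsrc (IdBase b) = Base b"
| "gsrc (Cross ToOp c d) = (ctgt c \<rightarrow>\<^sub>t csrc d)"
| "gsrc (Cross TimesOp c d) = (csrc c \<times>\<^sub>t csrc d)"
| "gsrc (Cross PlusOp c d) = (csrc c +\<^sub>t csrc d)"
| "gtgt (IdBase b) = Base b"
| "gtgt (Cross ToOp c d) = (csrc c \<rightarrow>\<^sub>t ctgt d)"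
| "gtgt (Cross TimesOp c d) = (ctgt c \<times>\<^sub>t ctgt d)"
| "gtgt (Cross PlusOp c d) = (ctgt c +\<^sub>t ctgt d)"

inductive inert :: "'l crcn \<Rightarrow> bool" where
  "inert (CrossC ToOp c d)"
| "inert (Mid (Inj g G))"

inductive active :: "'l crcn \<Rightarrow> bool" where
  "active IdDyn"
| "active (Mid (Gnd (IdBase b)))"
| "active (Proj G l i)"
| "active (Mid (Fail A l B))"
| "active (CrossC TimesOp c d)"
| "active (CrossC PlusOp c d)"

text \<open>Composition. Three clauses are not composition laws of well-typed coercions met in
  reduction. The last clauses of \<open>icompose\<close> and \<open>gcompose\<close> apply to ill-typed compositions only.
  The clause composing \<open>Inj g G\<close> with a failure whose source is the unknown type is there for
  totality: such a failure is well typed, but neither casts nor composition create it.\<close>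
function (sequential)
  ccompose :: "'l crcn \<Rightarrow> 'l crcn \<Rightarrow> 'l crcn"
  and icompose :: "'l icrcn \<Rightarrow> 'l crcn \<Rightarrow> 'l icrcn"
  and gicompose :: "'l gcrcn \<Rightarrow> 'l icrcn \<Rightarrow> 'l icrcn"
  and gcompose :: "'l gcrcn \<Rightarrow> 'l gcrcn \<Rightarrow> 'l gcrcn" where
  "ccompose IdDyn d = d"
| "ccompose (Proj G l i) d = Proj G l (icompose i d)"
| "ccompose (Mid i) d = Mid (icompose i d)"
| "icompose (Inj g G) IdDyn = Inj g G"
| "icompose (Inj g G) (Proj H l i) =
     (if G = H then gicompose g i else Fail (gsrc g) l (itgt i))"
| "icompose (Inj g G) (Mid (Fail A l B)) = Fail (gsrc g) l B"
| "icompose (Fail A l B) d = Fail A l (ctgt d)"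
| "icompose (Gnd g) (Mid i) = gicompose g i"
| "icompose i d = i"
| "gicompose g (Inj h H) = Inj (gcompose g h) H"
| "gicompose g (Gnd h) = Gnd (gcompose g h)"
| "gicompose g (Fail A l B) = Fail (gsrc g) l B"
| "gcompose (IdBase b) (IdBase b') = IdBase b"
| "gcompose (Cross ToOp c1 d1) (Cross ToOp c2 d2) = Cross ToOp (ccompose c2 c1) (ccompose d1 d2)"
| "gcompose (Cross TimesOp c1 d1) (Cross TimesOp c2 d2) =
     Cross TimesOp (ccompose c1 c2) (ccompose d1 d2)"
| "gcompose (Cross PlusOp c1 d1) (Cross PlusOp c2 d2) =
     Cross PlusOp (ccompose c1 c2) (ccompose d1 d2)"
| "gcompose g h = g"
  by pat_completeness auto
termination
  by (relation "measure (\<lambda>x. case x of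
        Inl (Inl (c, d)) \<Rightarrow> size c + size d
      | Inl (Inr (i, d)) \<Rightarrow> size i + size d
      | Inr (Inl (g, i)) \<Rightarrow> size g + size i
      | Inr (Inr (g, h)) \<Rightarrow> size g + size h)") auto

text \<open>\<open>coerce A B l\<close> is only used for consistent \<open>A\<close> and \<open>B\<close>; \<open>gcoerce\<close> is its restriction to
  types other than \<^term>\<open>Dyn\<close>, for which it is a ground coercion.\<close>
function (sequential)
  coerce :: "ty \<Rightarrow> ty \<Rightarrow> 'l \<Rightarrow> 'l crcn"
  and gcoerce :: "ty \<Rightarrow> ty \<Rightarrow> 'l \<Rightarrow> 'l gcrcn" where
  "coerce Dyn Dyn l = IdDyn"
| "coerce A Dyn l = Mid (Inj (gcoerce A (ty_of_gnd (gnd A)) l) (gnd A))"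
| "coerce Dyn A l = Proj (gnd A) l (Gnd (gcoerce (ty_of_gnd (gnd A)) A l))"
| "coerce A B l = Mid (Gnd (gcoerce A B l))"
| "gcoerce (Base b) B l = IdBase b"
| "gcoerce (A \<rightarrow>\<^sub>t B) (Op p A' B') l = Cross ToOp (coerce A' A l) (coerce B B' l)"
| "gcoerce (Op p A B) (Op p' A' B') l = Cross p (coerce A A' l) (coerce B B' l)"
| "gcoerce A B l = undefined"
  by pat_completeness auto
termination
  by (relation "measure (\<lambda>x. case x of
        Inl (A, B, l) \<Rightarrow> 2 * max (size A) (size B) + 1
      | Inr (A, B, l) \<Rightarrow> 2 * max (size A) (size B))") (auto simp: max_def)

fun csize :: "'l crcn \<Rightarrow> nat" and isize :: "'l icrcn \<Rightarrow> nat" and gsize :: "'l gcrcn \<Rightarrow> nat" where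
  "csize IdDyn = 0"
| "csize (Proj G l i) = 2 + isize i"
| "csize (Mid i) = isize i"
| "isize (Inj g G) = 2 + gsize g"
| "isize (Gnd g) = gsize g"
| "isize (Fail A l B) = 0"
| "gsize (IdBase b) = 0"
| "gsize (Cross p c d) = 1 + csize c + csize d"

section \<open>Terms of the coercion calculus\<close>

text \<open>Intrinsically typed terms are represented by terms with a typing relation. Abstractions
  and blame are annotated (with the type of the bound variable and with the type of the whole
  term), so that a term has at most one type and one typing derivation in each context.\<close>
datatype 'l tm =
    TConst den prim
  | TVar nat
  | TLam ty "'l tm"
  | TApp "'l tm" "'l tm"
  | TIf "'l tm" "'l tm" "'l tm"
  | TCons "'l tm" "'l tm"
  | TFst "'l tm"
  | TSnd "'l tm"
  | TInl ty "'l tm"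
  | TInr ty "'l tm"
  | TCase "'l tm" "'l tm" "'l tm"
  | TCast "'l tm" "'l crcn"
  | TBlame ty 'l

inductive typing :: "ctxt \<Rightarrow> 'l tm \<Rightarrow> ty \<Rightarrow> bool" ("_ \<turnstile>\<^sub>S _ : _" [51, 51, 51] 50) where
  "k \<in> prim_sem P \<Longrightarrow> \<Gamma> \<turnstile>\<^sub>S TConst k P : ty_of_prim P"
| "x < length \<Gamma> \<Longrightarrow> \<Gamma> \<turnstile>\<^sub>S TVar x : \<Gamma> ! x"
| "A # \<Gamma> \<turnstile>\<^sub>S M : B \<Longrightarrow> \<Gamma> \<turnstile>\<^sub>S TLam A M : A \<rightarrow>\<^sub>t B"
| "\<Gamma> \<turnstile>\<^sub>S L : A \<rightarrow>\<^sub>t B \<Longrightarrow> \<Gamma> \<turnstile>\<^sub>S M : A \<Longrightarrow> \<Gamma> \<turnstile>\<^sub>S TApp L M : B"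
| "\<Gamma> \<turnstile>\<^sub>S L : Base BBool \<Longrightarrow> \<Gamma> \<turnstile>\<^sub>S M : B \<Longrightarrow> \<Gamma> \<turnstile>\<^sub>S N : B \<Longrightarrow> \<Gamma> \<turnstile>\<^sub>S TIf L M N : B"
| "\<Gamma> \<turnstile>\<^sub>S M : A \<Longrightarrow> \<Gamma> \<turnstile>\<^sub>S N : B \<Longrightarrow> \<Gamma> \<turnstile>\<^sub>S TCons M N : A \<times>\<^sub>t B"
| "\<Gamma> \<turnstile>\<^sub>S M : A1 \<times>\<^sub>t A2 \<Longrightarrow> \<Gamma> \<turnstile>\<^sub>S TFst M : A1"
| "\<Gamma> \<turnstile>\<^sub>S M : A1 \<times>\<^sub>t A2 \<Longrightarrow> \<Gamma> \<turnstile>\<^sub>S TSnd M : A2"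
| "\<Gamma> \<turnstile>\<^sub>S M : A \<Longrightarrow> \<Gamma> \<turnstile>\<^sub>S TInl B M : A +\<^sub>t B"
| "\<Gamma> \<turnstile>\<^sub>S M : B \<Longrightarrow> \<Gamma> \<turnstile>\<^sub>S TInr A M : A +\<^sub>t B"
| "\<Gamma> \<turnstile>\<^sub>S L : A1 +\<^sub>t A2 \<Longrightarrow> \<Gamma> \<turnstile>\<^sub>S M : A1 \<rightarrow>\<^sub>t B \<Longrightarrow> \<Gamma> \<turnstile>\<^sub>S N : A2 \<rightarrow>\<^sub>t B \<Longrightarrow> \<Gamma> \<turnstile>\<^sub>S TCase L M N : B"
| "\<Gamma> \<turnstile>\<^sub>S M : A \<Longrightarrow> c : A \<Rightarrow>\<^sub>c B \<Longrightarrow> \<Gamma> \<turnstile>\<^sub>S TCast M c : B"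
| "\<Gamma> \<turnstile>\<^sub>S TBlame A l : A"

fun ideal_size :: "'l tm \<Rightarrow> nat" where
  "ideal_size (TConst k P) = 1"
| "ideal_size (TVar x) = 1"
| "ideal_size (TLam A M) = 1 + ideal_size M"
| "ideal_size (TApp L M) = 1 + ideal_size L + ideal_size M"
| "ideal_size (TIf L M N) = 1 + ideal_size L + ideal_size M + ideal_size N"
| "ideal_size (TCons M N) = 1 + ideal_size M + ideal_size N"
| "ideal_size (TFst M) = 1 + ideal_size M"
| "ideal_size (TSnd M) = 1 + ideal_size M"
| "ideal_size (TInl B M) = 1 + ideal_size M"
| "ideal_size (TInr A M) = 1 + ideal_size M"
| "ideal_size (TCase L M N) = 1 + ideal_size L + ideal_size M + ideal_size N"
| "ideal_size (TCast M c) = ideal_size M"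
| "ideal_size (TBlame A l) = 1"

fun real_size :: "'l tm \<Rightarrow> nat" where
  "real_size (TConst k P) = 1"
| "real_size (TVar x) = 1"
| "real_size (TLam A M) = 1 + real_size M"
| "real_size (TApp L M) = 1 + real_size L + real_size M"
| "real_size (TIf L M N) = 1 + real_size L + real_size M + real_size N"
| "real_size (TCons M N) = 1 + real_size M + real_size N"
| "real_size (TFst M) = 1 + real_size M"
| "real_size (TSnd M) = 1 + real_size M"
| "real_size (TInl B M) = 1 + real_size M"
| "real_size (TInr A M) = 1 + real_size M"
| "real_size (TCase L M N) = 1 + real_size L + real_size M + real_size N"
| "real_size (TCast M c) = csize c + real_size M"
| "real_size (TBlame A l) = 1"

section \<open>Compilation\<close>

fun compile :: "ctxt \<Rightarrow> 'l gterm \<Rightarrow> 'l tm" where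
  "compile \<Gamma> (GConst k P) = TConst k P"
| "compile \<Gamma> (GVar x) = TVar x"
| "compile \<Gamma> (GLam A M) = TLam A (compile (A # \<Gamma>) M)"
| "compile \<Gamma> (GApp L M l) =
    (let A = gtype_of \<Gamma> L; B = gtype_of \<Gamma> M; A1 = mfst A; A2 = msnd A
     in TApp (TCast (compile \<Gamma> L) (coerce A (A1 \<rightarrow>\<^sub>t A2) l))
             (TCast (compile \<Gamma> M) (coerce B A1 l)))"
| "compile \<Gamma> (GIf l L M N) =
    (let A = gtype_of \<Gamma> L; B = gtype_of \<Gamma> M; C = gtype_of \<Gamma> N
     in TIf (TCast (compile \<Gamma> L) (coerce A (Base BBool) l))
            (TCast (compile \<Gamma> M) (coerce B (B \<squnion>\<^sub>t C) l))
            (TCast (compile \<Gamma> N) (coerce C (B \<squnion>\<^sub>t C) l)))"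
| "compile \<Gamma> (GCons M N) = TCons (compile \<Gamma> M) (compile \<Gamma> N)"
| "compile \<Gamma> (GFst l M) =
    (let A = gtype_of \<Gamma> M
     in TFst (TCast (compile \<Gamma> M) (coerce A (mfst A \<times>\<^sub>t msnd A) l)))"
| "compile \<Gamma> (GSnd l M) =
    (let A = gtype_of \<Gamma> M
     in TSnd (TCast (compile \<Gamma> M) (coerce A (mfst A \<times>\<^sub>t msnd A) l)))"
| "compile \<Gamma> (GInl B M) = TInl B (compile \<Gamma> M)"
| "compile \<Gamma> (GInr A M) = TInr A (compile \<Gamma> M)"
| "compile \<Gamma> (GCase l B1 C1 L M N) =
    (let A = gtype_of \<Gamma> L; B2 = gtype_of (B1 # \<Gamma>) M; C2 = gtype_of (C1 # \<Gamma>) N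
     in TCase (TCast (compile \<Gamma> L) (coerce A (B1 +\<^sub>t C1) l))
              (TLam B1 (TCast (compile (B1 # \<Gamma>) M) (coerce B2 (B2 \<squnion>\<^sub>t C2) l)))
              (TLam C1 (TCast (compile (C1 # \<Gamma>) N) (coerce C2 (B2 \<squnion>\<^sub>t C2) l))))"

section \<open>Reduction\<close>

text \<open>\<open>lift n M\<close> makes room for a new variable \<open>n\<close>; \<open>lift 0\<close> is weakening.\<close>
fun lift :: "nat \<Rightarrow> 'l tm \<Rightarrow> 'l tm" where
  "lift n (TConst k P) = TConst k P"
| "lift n (TVar x) = TVar (if x < n then x else Suc x)"
| "lift n (TLam A M) = TLam A (lift (Suc n) M)"
| "lift n (TApp L M) = TApp (lift n L) (lift n M)"
| "lift n (TIf L M N) = TIf (lift n L) (lift n M) (lift n N)"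
| "lift n (TCons M N) = TCons (lift n M) (lift n N)"
| "lift n (TFst M) = TFst (lift n M)"
| "lift n (TSnd M) = TSnd (lift n M)"
| "lift n (TInl B M) = TInl B (lift n M)"
| "lift n (TInr A M) = TInr A (lift n M)"
| "lift n (TCase L M N) = TCase (lift n L) (lift n M) (lift n N)"
| "lift n (TCast M c) = TCast (lift n M) c"
| "lift n (TBlame A l) = TBlame A l"

text \<open>\<open>subst n V M\<close> substitutes \<open>V\<close> for the variable \<open>n\<close> and removes that variable.\<close>
fun subst :: "nat \<Rightarrow> 'l tm \<Rightarrow> 'l tm \<Rightarrow> 'l tm" where
  "subst n V (TConst k P) = TConst k P"
| "subst n V (TVar x) = (if x < n then TVar x else if x = n then V else TVar (x - 1))"
| "subst n V (TLam A M) = TLam A (subst (Suc n) (lift 0 V) M)"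
| "subst n V (TApp L M) = TApp (subst n V L) (subst n V M)"
| "subst n V (TIf L M N) = TIf (subst n V L) (subst n V M) (subst n V N)"
| "subst n V (TCons M N) = TCons (subst n V M) (subst n V N)"
| "subst n V (TFst M) = TFst (subst n V M)"
| "subst n V (TSnd M) = TSnd (subst n V M)"
| "subst n V (TInl B M) = TInl B (subst n V M)"
| "subst n V (TInr A M) = TInr A (subst n V M)"
| "subst n V (TCase L M N) = TCase (subst n V L) (subst n V M) (subst n V N)"
| "subst n V (TCast M c) = TCast (subst n V M) c"
| "subst n V (TBlame A l) = TBlame A l"

inductive simple_value :: "'l tm \<Rightarrow> bool" and val :: "'l tm \<Rightarrow> bool" where
  "simple_value (TLam A M)"
| "simple_value (TConst k P)"
| "val V \<Longrightarrow> val W \<Longrightarrow> simple_value (TCons V W)"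
| "val V \<Longrightarrow> simple_value (TInl B V)"
| "val V \<Longrightarrow> simple_value (TInr A V)"
| "simple_value S \<Longrightarrow> val S"
| "simple_value S \<Longrightarrow> inert c \<Longrightarrow> val (TCast S c)"

datatype 'l frame =
    FAppL "'l tm"
  | FAppR "'l tm"
  | FIf "'l tm" "'l tm"
  | FConsR "'l tm"
  | FConsL "'l tm"
  | FFst
  | FSnd
  | FInl ty
  | FInr ty
  | FCase "'l tm" "'l tm"

fun plug :: "'l frame \<Rightarrow> 'l tm \<Rightarrow> 'l tm" where
  "plug (FAppL M) X = TApp X M"
| "plug (FAppR V) X = TApp V X"
| "plug (FIf M N) X = TIf X M N"
| "plug (FConsR V) X = TCons V X"
| "plug (FConsL N) X = TCons X N"
| "plug FFst X = TFst X"
| "plug FSnd X = TSnd X"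
| "plug (FInl B) X = TInl B X"
| "plug (FInr A) X = TInr A X"
| "plug (FCase M N) X = TCase X M N"

fun wf_frame :: "'l frame \<Rightarrow> bool" where
  "wf_frame (FAppR V) = val V"
| "wf_frame (FConsR V) = val V"
| "wf_frame F = True"

text \<open>The last clause covers the combinations that do not arise for a well-typed cast of a
  simple value by an active coercion.\<close>
fun apply_cast :: "'l tm \<Rightarrow> 'l crcn \<Rightarrow> 'l tm" where
  "apply_cast S IdDyn = S"
| "apply_cast S (Mid (Gnd (IdBase b))) = S"
| "apply_cast S (Mid (Fail A l B)) = TBlame B l"
| "apply_cast (TCons V1 V2) (CrossC TimesOp c d) = TCons (TCast V1 c) (TCast V2 d)"
| "apply_cast (TInl B V) (CrossC PlusOp c d) = TInl (ctgt d) (TCast V c)"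
| "apply_cast (TInr A V) (CrossC PlusOp c d) = TInr (ctgt c) (TCast V d)"
| "apply_cast S c = TCast S c"

datatype rctx = Any | NonCast

text \<open>The context \<open>\<Gamma>\<close> is that of the terms being reduced; it only serves to annotate a blame
  that is propagated out of a frame with its new type.\<close>
inductive step :: "ctxt \<Rightarrow> rctx \<Rightarrow> 'l tm \<Rightarrow> 'l tm \<Rightarrow> bool" for \<Gamma> where
  cong: "step \<Gamma> ctx M M' \<Longrightarrow> wf_frame F \<Longrightarrow> step \<Gamma> Any (plug F M) (plug F M')"
| cong_cast: "step \<Gamma> Any M M' \<Longrightarrow> step \<Gamma> NonCast (TCast M c) (TCast M' c)"
| blame_frame: "wf_frame F \<Longrightarrow> \<Gamma> \<turnstile>\<^sub>S plug F (TBlame A l) : B \<Longrightarrow>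
    step \<Gamma> Any (plug F (TBlame A l)) (TBlame B l)"
| blame_cast: "step \<Gamma> NonCast (TCast (TBlame A l) c) (TBlame (ctgt c) l)"
| cast: "simple_value S \<Longrightarrow> active c \<Longrightarrow> step \<Gamma> NonCast (TCast S c) (apply_cast S c)"
| compose_casts: "step \<Gamma> NonCast (TCast (TCast M c) d) (TCast M (ccompose c d))"
| fun_cast: "val V \<Longrightarrow> val W \<Longrightarrow>
    step \<Gamma> Any (TApp (TCast V (CrossC ToOp c d)) W) (TCast (TApp V (TCast W c)) d)"
| fst_cast: "val V \<Longrightarrow>
    step \<Gamma> Any (TFst (TCast V (CrossC TimesOp c d))) (TCast (TFst V) c)"
| snd_cast: "val V \<Longrightarrow>
    step \<Gamma> Any (TSnd (TCast V (CrossC TimesOp c d))) (TCast (TSnd V) d)"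
| case_cast: "val V \<Longrightarrow>
    step \<Gamma> Any (TCase (TCast V (CrossC PlusOp c d)) M N)
      (TCase V (TLam (csrc c) (TApp (lift 0 M) (TCast (TVar 0) c)))
               (TLam (csrc d) (TApp (lift 0 N) (TCast (TVar 0) d))))"
| beta: "val V \<Longrightarrow> step \<Gamma> Any (TApp (TLam A M) V) (subst 0 V M)"
| if_true: "step \<Gamma> Any (TIf (TConst (DBase (VBool True)) (PBase BBool)) M N) M"
| if_false: "step \<Gamma> Any (TIf (TConst (DBase (VBool False)) (PBase BBool)) M N) N"
| fst_cons: "val V \<Longrightarrow> val W \<Longrightarrow> step \<Gamma> Any (TFst (TCons V W)) V"
| snd_cons: "val V \<Longrightarrow> val W \<Longrightarrow> step \<Gamma> Any (TSnd (TCons V W)) W"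
| case_inl: "val V \<Longrightarrow> step \<Gamma> Any (TCase (TInl B V) L M) (TApp L V)"
| case_inr: "val V \<Longrightarrow> step \<Gamma> Any (TCase (TInr A V) L M) (TApp M V)"
| delta: "step \<Gamma> Any (TApp (TConst (DFun f) (PFun b P)) (TConst (DBase v) (PBase b)))
    (TConst (f v) P)"

definition steps :: "ctxt \<Rightarrow> 'l tm \<Rightarrow> 'l tm \<Rightarrow> bool" where
  "steps \<Gamma> = (\<lambda>M N. \<exists>ctx. step \<Gamma> ctx M N)\<^sup>*\<^sup>*"

end

theory Submission
  imports Defs "HOL.Filter"
begin

text \<open>Composition does not increase the height of coercions, and the size of a coercion is
  bounded in terms of its height, so every coercion met in a reduction has a size bounded by a
  constant. It remains to bound the number of adjacent casts. In code that is not being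
  evaluated (below binders and in branches) there is at most one cast around a variable and at most
  two around any other term: a value carries at most one cast, so substituting it for a
  variable keeps this bound. Evaluation places such code below at most one further cast, and
  three adjacent casts have to be composed before any other step happens there.\<close>

section \<open>Height of coercions\<close>

fun cheight :: "'l crcn \<Rightarrow> nat" and iheight :: "'l icrcn \<Rightarrow> nat" and gheight :: "'l gcrcn \<Rightarrow> nat" where
  "cheight IdDyn = 0"
| "cheight (Proj G l i) = iheight i"
| "cheight (Mid i) = iheight i"
| "iheight (Inj g G) = gheight g"
| "iheight (Gnd g) = gheight g"
| "iheight (Fail A l B) = 0"
| "gheight (IdBase b) = 0"
| "gheight (Cross p c d) = Suc (max (cheight c) (cheight d))"

lemma compose_height:
  "cheight (ccompose c d) \<le> max (cheight c) (cheight d)"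
  "iheight (icompose i d) \<le> max (iheight i) (cheight d)"
  "iheight (gicompose g i) \<le> max (gheight g) (iheight i)"
  "gheight (gcompose g h) \<le> max (gheight g) (gheight h)"
  by (induction c d and i d and g i and g h rule: ccompose_icompose_gicompose_gcompose.induct) auto

text \<open>The constants close the induction: the drops from 9 to 7 to 5 pay for the 2 of
  \<open>Inj\<close> and of \<open>Proj\<close>, and \<open>Cross\<close> uses 1 + 9 = 5 +
  5.\<close>

lemma size_le_height:
  fixes c :: "'l crcn" and i :: "'l icrcn" and g :: "'l gcrcn"
  shows "csize c + 5 \<le> 9 * 2 ^ cheight c"
    and "isize i + 7 \<le> 9 * 2 ^ iheight i"
    and "gsize g + 9 \<le> 9 * 2 ^ gheight g"
proof (induction c and i and g)
  case (Cross p c d)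
  have "(2::nat) ^ cheight c \<le> 2 ^ max (cheight c) (cheight d)"
    "(2::nat) ^ cheight d \<le> 2 ^ max (cheight c) (cheight d)"
    by (simp_all add: power_increasing)
  with Cross show ?case
    unfolding gsize.simps gheight.simps power_Suc by linarith
qed (auto intro: order_trans)

section \<open>Adjacent casts\<close>

definition var_casts :: "bool \<Rightarrow> nat" where "var_casts static = (if static then 1 else 3)"
definition tm_casts :: "bool \<Rightarrow> nat" where "tm_casts static = (if static then 2 else 3)"

text \<open>\<open>bounded s H k M\<close>: the coercions of \<open>M\<close> have height at most \<open>H\<close>, and below \<open>k\<close> casts the
  bounds on adjacent casts hold in \<open>M\<close>; the flag \<open>s\<close> tells whether \<open>M\<close> is static, i.e. not
  being evaluated. Case branches are static because a cast on the scrutinee moves them below a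
  binder, and conditional branches because they may end up below a further cast.\<close>
fun bounded :: "bool \<Rightarrow> nat \<Rightarrow> nat \<Rightarrow> 'l tm \<Rightarrow> bool" where
  "bounded s H k (TConst c P) \<longleftrightarrow> k \<le> tm_casts s"
| "bounded s H k (TVar x) \<longleftrightarrow> k \<le> var_casts s"
| "bounded s H k (TLam A M) \<longleftrightarrow> k \<le> tm_casts s \<and> bounded True H 0 M"
| "bounded s H k (TApp L M) \<longleftrightarrow> k \<le> tm_casts s \<and> bounded s H 0 L \<and> bounded s H 0 M"
| "bounded s H k (TIf L M N) \<longleftrightarrow>
     k \<le> tm_casts s \<and> bounded s H 0 L \<and> bounded True H 0 M \<and> bounded True H 0 N"
| "bounded s H k (TCons M N) \<longleftrightarrow> k \<le> tm_casts s \<and> bounded s H 0 M \<and> bounded s H 0 N"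
| "bounded s H k (TFst M) \<longleftrightarrow> k \<le> tm_casts s \<and> bounded s H 0 M"
| "bounded s H k (TSnd M) \<longleftrightarrow> k \<le> tm_casts s \<and> bounded s H 0 M"
| "bounded s H k (TInl B M) \<longleftrightarrow> k \<le> tm_casts s \<and> bounded s H 0 M"
| "bounded s H k (TInr A M) \<longleftrightarrow> k \<le> tm_casts s \<and> bounded s H 0 M"
| "bounded s H k (TCase L M N) \<longleftrightarrow>
     k \<le> tm_casts s \<and> bounded s H 0 L \<and> bounded True H 0 M \<and> bounded True H 0 N"
| "bounded s H k (TCast M c) \<longleftrightarrow> cheight c \<le> H \<and> bounded s H (Suc k) M"
| "bounded s H k (TBlame A l) \<longleftrightarrow> k \<le> tm_casts s"

lemma bounded_antimono: "bounded s H k M \<Longrightarrow> k' \<le> k \<Longrightarrow> bounded s H k' M"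
  by (induction M arbitrary: k k') auto

lemma bounded_static_imp_dynamic: "bounded True H k M \<Longrightarrow> bounded False H (Suc k) M"
  by (induction M arbitrary: k) (auto simp: tm_casts_def var_casts_def intro: bounded_antimono)

lemma bounded_lift: "bounded s H k (lift n M) \<longleftrightarrow> bounded s H k M"
  by (induction M arbitrary: s k n) auto

text \<open>A static variable lies below at most one cast, so \<open>V\<close> need only tolerate
  one.\<close>

lemma bounded_subst:
  "bounded True H k M \<Longrightarrow> bounded True H 1 V \<Longrightarrow> bounded True H k (subst n V M)"
  by (induction M arbitrary: k n V)
     (auto simp: bounded_lift var_casts_def intro: bounded_antimono)

text \<open>Components of values are values and bodies of abstractions are static already; the cast
  of a value uses up one of the two allowed.\<close>

lemma bounded_value:
  "simple_value M \<Longrightarrow> bounded False H k M \<Longrightarrow> bounded True H 2 M"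
  "val M \<Longrightarrow> bounded False H k M \<Longrightarrow> bounded True H 1 M"
  by (induction arbitrary: k and k rule: simple_value_val.inducts)
     (auto simp: tm_casts_def numeral_2_eq_2 intro: bounded_antimono)

lemma bounded_value_dynamic:
  assumes "val V" "bounded False H k V"
  shows "bounded False H 0 V" "bounded False H 1 V" "bounded False H 2 V"
  using bounded_static_imp_dynamic[OF bounded_value(2)[OF assms]]
  by (auto simp: numeral_2_eq_2 intro: bounded_antimono)

inductive_simps simple_value_simps:
  "simple_value (TCons V W)" "simple_value (TInl B V)" "simple_value (TInr A V)"

lemma bounded_apply_cast:
  assumes "simple_value S" "bounded False H 1 S" "cheight c \<le> H"
  shows "bounded False H 0 (apply_cast S c)"
  using assms
  by (induction S c rule: apply_cast.induct)
     (auto simp: tm_casts_def simple_value_simps bounded_value_dynamic[unfolded One_nat_def]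
       intro: bounded_antimono)

lemma bounded_plug:
  assumes "bounded False H 0 (plug F M)"
  shows "bounded False H 0 M"
    and "bounded False H 0 M' \<Longrightarrow> k \<le> 3 \<Longrightarrow> bounded False H k (plug F M')"
  using assms by (cases F; simp add: tm_casts_def)+

text \<open>A step in context \<^const>\<open>Any\<close> may happen directly below a cast, whence the slack of one.\<close>
lemma bounded_step:
  "step \<Gamma> ctx M M' \<Longrightarrow> bounded False H 0 M \<Longrightarrow> bounded False H (if ctx = Any then 1 else 0) M'"
proof (induction rule: step.induct)
  case (cong ctx M M' F)
  have "bounded False H 0 M'"
    using cong.IH[OF bounded_plug(1)[OF cong.prems]] by (rule bounded_antimono) simp
  then show ?case
    using bounded_plug(2)[OF cong.prems] by simp
next
  case (cong_cast M M' c)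
  then have "bounded False H 1 M'"
    using bounded_antimono[of False H 1 M 0] by simp
  with cong_cast.prems show ?case
    by simp
next
  case (cast S c)
  then show ?case
    by (simp add: bounded_apply_cast)
next
  case (compose_casts M c d)
  then show ?case
    using order_trans[OF compose_height(1)[of c d], of H] bounded_antimono[of False H 2 M 1]
    by (simp add: numeral_2_eq_2)
next
  case (beta V A M)
  \<comment> \<open>The contractum is static, which leaves room for one more cast.\<close>
  then show ?case
    using bounded_static_imp_dynamic[OF bounded_subst[of H 0 M V 0]] bounded_value(2)[of V H 0]
    by simp
qed (auto simp: tm_casts_def var_casts_def bounded_lift bounded_static_imp_dynamic
       bounded_antimono[OF bounded_static_imp_dynamic, of H 0 _ 0]
       bounded_value_dynamic(1)[of _ H "Suc 0"]
       bounded_value_dynamic(2)[of _ H 0, unfolded One_nat_def]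
       bounded_value_dynamic(3)[of _ H 0, unfolded numeral_2_eq_2])

lemma bounded_steps: "steps \<Gamma> M M' \<Longrightarrow> bounded False H 0 M \<Longrightarrow> bounded False H 0 M'"
  unfolding steps_def
  by (induction rule: rtranclp_induct) (auto dest!: bounded_step intro: bounded_antimono)

text \<open>The filter spares computing a maximal height. A compiled term is never itself a cast and
  gets at most one from its parent.\<close>

lemma bounded_compile: "\<forall>\<^sub>F H in at_top. bounded True H 1 (compile \<Gamma> M)"
proof -
  have *: "\<forall>\<^sub>F H in at_top. bounded True H 0 N" if "\<forall>\<^sub>F H in at_top. bounded True H 1 N" for N :: "'l tm"
    using that by (rule eventually_mono) (auto intro: bounded_antimono)
  show ?thesis
    by (induction \<Gamma> M rule: compile.induct)
       (auto simp: tm_casts_def var_casts_def Let_def eventually_conj_iff eventually_ge_at_top *)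
qed

section \<open>Size of terms\<close>

text \<open>The casts around \<open>M\<close> are charged to \<open>M\<close>, each with its maximal size.\<close>
lemma bounded_size:
  assumes "bounded s H k M" and "K = 9 * 2 ^ H" and "C = 1 + 3 * K"
  shows "real_size M + k * K \<le> C * ideal_size M"
proof -
  \<comment> \<open>Each node other than a cast pays for itself and at most three casts.\<close>
  have *: "1 + k * K \<le> C" if "k \<le> tm_casts s" for k s
  proof -
    have "k \<le> 3"
      using that by (auto simp: tm_casts_def split: if_splits)
    then show ?thesis
      by (simp add: assms(3))
  qed
  show ?thesis
    using assms(1)
  proof (induction M arbitrary: s k)
    case (TCast M c)
    have "csize c \<le> 9 * 2 ^ cheight c"
      using size_le_height(1)[of c] by simp
    also have "\<dots> \<le> K"
      using TCast.prems by (simp add: assms(2) power_increasing)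
    finally show ?case
      using TCast.IH[of s "Suc k"] TCast.prems by simp
  next
    case (TVar x)
    then have "k \<le> tm_casts s"
      by (auto simp: var_casts_def tm_casts_def split: if_splits)
    then show ?case
      using *[of k s] by simp
  next
    case (TLam A M)
    then show ?case
      using TLam.IH[of True 0] *[of k s] by (simp add: distrib_left)
  next
    case (TApp L M)
    then show ?case
      using TApp.IH[of s 0] *[of k s] by (simp add: distrib_left)
  next
    case (TIf L M N)
    then show ?case
      using TIf.IH(1)[of s 0] TIf.IH(2,3)[of True 0] *[of k s] by (simp add: distrib_left)
  next
    case (TCons M N)
    then show ?case
      using TCons.IH[of s 0] *[of k s] by (simp add: distrib_left)
  next
    case (TFst M)
    then show ?case
      using TFst.IH[of s 0] *[of k s] by (simp add: distrib_left)
  next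
    case (TSnd M)
    then show ?case
      using TSnd.IH[of s 0] *[of k s] by (simp add: distrib_left)
  next
    case (TInl B M)
    then show ?case
      using TInl.IH[of s 0] *[of k s] by (simp add: distrib_left)
  next
    case (TInr A M)
    then show ?case
      using TInr.IH[of s 0] *[of k s] by (simp add: distrib_left)
  next
    case (TCase L M N)
    then show ?case
      using TCase.IH(1)[of s 0] TCase.IH(2,3)[of True 0] *[of k s] by (simp add: distrib_left)
  qed (use * in force)+
qed

theorem corollary136:
  fixes M :: "'l gterm" and \<Gamma> :: ctxt and A :: ty
  assumes "\<Gamma> \<turnstile>\<^sub>G M : A"
  shows "\<exists>c::nat. \<forall>M'. \<Gamma> \<turnstile>\<^sub>S M' : A \<longrightarrow> steps \<Gamma> (compile \<Gamma> M) M' \<longrightarrow>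
           real_size M' \<le> c * ideal_size M'"
proof -
  obtain H where "bounded True H 1 (compile \<Gamma> M)"
    using bounded_compile[of \<Gamma> M] unfolding eventually_at_top_linorder by blast
  then have "bounded False H 0 (compile \<Gamma> M)"
    using bounded_antimono[OF bounded_static_imp_dynamic] by blast
  then have "real_size M' \<le> (1 + 3 * (9 * 2 ^ H)) * ideal_size M'"
    if "steps \<Gamma> (compile \<Gamma> M) M'" for M'
    using bounded_size[OF bounded_steps[OF that] refl refl] by simp
  then show ?thesis
    by blast
qed

end
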